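(* Let $G=(V,E)$ be a connected simple graph with $V=[n]$ and $E=\{e_1,\dots,e_m\}$, let $\mathbf x=(x_1,\dots,x_m)^\top$ with all $x_k>0$ be an edge weight vector giving the positive-weighted graph $G^w$ (weight $x_k$ on $e_k$), with Laplacian matrix $L$. Let $\Delta\mathbf x=(\Delta x_1,\dots,\Delta x_m)^\top\in\mathbb{R}^m$ with $x_k+\Delta x_k>0$ for all $k$, and let $L_1$ be the matrix defined by $(L_1)_{st}=-\Delta x_k$ if $\{s,t\}=e_k\in E$, $(L_1)_{st}=0$ if $s\ne t$ and $\{s,t\}\notin E$, and $(L_1)_{ss}=\sum_{t\neq s}(-(L_1)_{st})$. Then: (a) For all $i,j\in[n]$, $(\Delta\mathbf{x})^\top \nabla^2 R_{ij}(\mathbf{x}) \Delta\mathbf{x} = 2(L^\dagger L_1 L^\dagger L_1 L^\dagger)^{(i,j)}$. (b) $(\Delta\mathbf{x})^\top \nabla^2 Kf_G(\mathbf{x}) \Delta\mathbf{x} = 2n\,\mathrm{tr}((L^\dagger)^2 L_1 L^\dagger L_1)$.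
   Context: For a connected graph $G$ with positive edge weights $\mathbf x$, the Laplacian is $L=D-A$ where $A_{st}=x_k$ if $\{s,t\}=e_k\in E$ and $0$ otherwise, and $D$ is the diagonal matrix of row sums of $A$. $L^\dagger$ is the Moore–Penrose inverse of $L$. The resistance distance between vertices $i,j$ is $R_{ij}(\mathbf x)=(L^\dagger)^{(i,j)}$ and the Kirchhoff index is $Kf_G(\mathbf x)=\sum_{i<j}R_{ij}(\mathbf x)$, both viewed as functions of $\mathbf x$ on the open set $\{\mathbf x\in\mathbb{R}^m: x_k>0\ \forall k\}$. For a square matrix $P$, $P^{(i,j)}=P_{ii}+P_{jj}-P_{ij}-P_{ji}$. $\nabla^2 f(\mathbf x)=(\partial^2 f/\partial x_k\partial x_l)_{m\times m}$ is the Hessian matrix. *)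

theory Defs
  imports "HOL-Analysis.Analysis"
begin

definition simple_graph_edges :: "'n set set \<Rightarrow> bool" where
  "simple_graph_edges E \<longleftrightarrow> (\<forall>a\<in>E. card a = 2)"

definition connected_graph :: "'n set set \<Rightarrow> bool" where
  "connected_graph E \<longleftrightarrow> (\<forall>u v. (u, v) \<in> {(s, t). {s, t} \<in> E}\<^sup>*)"

text \<open>
  A graph on the vertex set \<open>UNIV :: 'n set\<close> has its edges enumerated as \<open>e 1, \<dots>, e m\<close>.
  A vector in the \<open>m\<close>-dimensional space is represented by its coordinates \<open>x 1, \<dots>, x m\<close>,
  where \<open>x :: nat \<Rightarrow> real\<close>; values outside \<open>{1..m}\<close> are irrelevant. In contrast to
  \<open>real ^ 'm\<close> this admits \<open>m = 0\<close>, i.e. the graph with one vertex and no edges.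
\<close>

definition adjacency_matrix ::
    "nat \<Rightarrow> (nat \<Rightarrow> 'n set) \<Rightarrow> (nat \<Rightarrow> real) \<Rightarrow> real ^ 'n ^ 'n" where
  "adjacency_matrix m e x =
     (\<chi> s t. if {s, t} \<in> e ` {1..m} then x (the_inv_into {1..m} e {s, t}) else 0)"

definition degree_matrix ::
    "nat \<Rightarrow> (nat \<Rightarrow> 'n::finite set) \<Rightarrow> (nat \<Rightarrow> real) \<Rightarrow> real ^ 'n ^ 'n" where
  "degree_matrix m e x =
     (\<chi> s t. if s = t then (\<Sum>u\<in>UNIV. adjacency_matrix m e x $ s $ u) else 0)"

definition laplacian ::
    "nat \<Rightarrow> (nat \<Rightarrow> 'n::finite set) \<Rightarrow> (nat \<Rightarrow> real) \<Rightarrow> real ^ 'n ^ 'n" where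
  "laplacian m e x = degree_matrix m e x - adjacency_matrix m e x"

definition is_moore_penrose :: "real ^ 'n ^ 'm \<Rightarrow> real ^ 'm ^ 'n \<Rightarrow> bool" where
  "is_moore_penrose A X \<longleftrightarrow>
     A ** X ** A = A \<and> X ** A ** X = X \<and>
     transpose (A ** X) = A ** X \<and> transpose (X ** A) = X ** A"

lemma is_moore_penrose_unique:
  assumes X: "is_moore_penrose A X" and Y: "is_moore_penrose A Y"
  shows "X = Y"
proof -
  have AXAY: "A ** X = A ** Y"
  proof -
    have "A ** X = transpose (A ** Y ** A ** X)"
      using X Y by (simp add: is_moore_penrose_def)
    also have "\<dots> = transpose (A ** X) ** transpose (A ** Y)"
      by (simp add: matrix_transpose_mul matrix_mul_assoc)
    also have "\<dots> = A ** X ** A ** Y"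
      using X Y by (simp add: is_moore_penrose_def matrix_mul_assoc)
    also have "\<dots> = A ** Y" using X by (simp add: is_moore_penrose_def)
    finally show ?thesis .
  qed
  have XAYA: "X ** A = Y ** A"
  proof -
    have "X ** A = transpose (X ** (A ** Y ** A))"
      using X Y by (simp add: is_moore_penrose_def)
    also have "\<dots> = transpose (Y ** A) ** transpose (X ** A)"
      by (simp add: matrix_transpose_mul matrix_mul_assoc)
    also have "\<dots> = (Y ** A) ** (X ** A)"
      using X Y by (simp add: is_moore_penrose_def)
    also have "\<dots> = Y ** (A ** X ** A)" by (simp only: matrix_mul_assoc)
    also have "\<dots> = Y ** A" using X by (simp add: is_moore_penrose_def)
    finally show ?thesis .
  qed
  have "X = X ** A ** X" using X by (simp add: is_moore_penrose_def)
  also have "\<dots> = Y ** (A ** X)" by (simp add: XAYA matrix_mul_assoc)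
  also have "\<dots> = Y ** A ** Y" by (simp add: AXAY matrix_mul_assoc)
  also have "\<dots> = Y" using Y by (simp add: is_moore_penrose_def)
  finally show ?thesis .
qed

definition moore_penrose_inverse :: "real ^ 'n ^ 'm \<Rightarrow> real ^ 'm ^ 'n" where
  "moore_penrose_inverse A = (THE X. is_moore_penrose A X)"

text \<open>The quantity written \<open>P\<close> with superscript \<open>(i,j)\<close>.\<close>

definition pair_form :: "real ^ 'n ^ 'n \<Rightarrow> 'n \<Rightarrow> 'n \<Rightarrow> real" where
  "pair_form P i j = P $ i $ i + P $ j $ j - P $ i $ j - P $ j $ i"

definition resistance ::
    "nat \<Rightarrow> (nat \<Rightarrow> 'n::finite set) \<Rightarrow> 'n \<Rightarrow> 'n \<Rightarrow> (nat \<Rightarrow> real) \<Rightarrow> real" where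
  "resistance m e i j x = pair_form (moore_penrose_inverse (laplacian m e x)) i j"

definition kirchhoff_index ::
    "nat \<Rightarrow> (nat \<Rightarrow> 'n::{finite,linorder} set) \<Rightarrow> (nat \<Rightarrow> real) \<Rightarrow> real" where
  "kirchhoff_index m e x = (\<Sum>(i, j)\<in>{(i, j). i < j}. resistance m e i j x)"

text \<open>
  Partial derivatives at \<open>x\<close> depend only on values near \<open>x\<close>, so at a positive weight vector it
  does not matter that the functions above are also given (meaningless) values outside
  the open set of positive weight vectors.
\<close>

definition partial_deriv :: "nat \<Rightarrow> ((nat \<Rightarrow> real) \<Rightarrow> real) \<Rightarrow> (nat \<Rightarrow> real) \<Rightarrow> real" where
  "partial_deriv k f x = deriv (\<lambda>t. f (x(k := t))) (x k)"

definition partially_differentiable ::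
    "nat \<Rightarrow> ((nat \<Rightarrow> real) \<Rightarrow> real) \<Rightarrow> (nat \<Rightarrow> real) \<Rightarrow> bool" where
  "partially_differentiable k f x \<longleftrightarrow> (\<lambda>t. f (x(k := t))) differentiable (at (x k))"

definition hessian ::
    "((nat \<Rightarrow> real) \<Rightarrow> real) \<Rightarrow> (nat \<Rightarrow> real) \<Rightarrow> nat \<Rightarrow> nat \<Rightarrow> real" where
  "hessian f x k l = partial_deriv k (partial_deriv l f) x"

text \<open>
  Since \<open>deriv\<close> is total, existence of the second-order partial derivatives in the directions
  \<open>1, \<dots>, m\<close> is expressed separately: the inner derivative has to exist on a neighbourhood of \<open>x\<close>
  along the line on which the outer one is taken.
\<close>

definition hessian_exists ::
    "nat \<Rightarrow> ((nat \<Rightarrow> real) \<Rightarrow> real) \<Rightarrow> (nat \<Rightarrow> real) \<Rightarrow> bool" where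
  "hessian_exists m f x \<longleftrightarrow>
     (\<forall>k\<in>{1..m}. \<forall>l\<in>{1..m}.
        (\<forall>\<^sub>F t in nhds (x k). partially_differentiable l f (x(k := t))) \<and>
        partially_differentiable k (partial_deriv l f) x)"

definition quadratic_form :: "nat \<Rightarrow> (nat \<Rightarrow> nat \<Rightarrow> real) \<Rightarrow> (nat \<Rightarrow> real) \<Rightarrow> real" where
  "quadratic_form m H v = (\<Sum>k=1..m. \<Sum>l=1..m. v k * H k l * v l)"

end

theory Submission
  imports Defs
begin

text \<open>
  Let \<open>J\<close> be the matrix with all entries \<open>1 / n\<close>. For positive weights on a connected graph
  the kernel of the Laplacian \<open>L\<close> consists of the constant vectors, so \<open>L + J\<close> is invertible and
  \<open>G = (L + J)\<^sup>-\<^sup>1 - J\<close> satisfies \<open>L G = G L = 1 - J\<close> and \<open>J G = G J = 0\<close>; hence \<open>G\<close> is the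
  Moore-Penrose inverse. For two positive weight vectors this yields the resolvent identity
  \<open>G' - G = G' (L - L') G\<close>. As \<open>L\<close> depends linearly on the weights, with coefficient \<open>B\<^sub>k\<close> of
  \<open>x\<^sub>k\<close>, the partial derivatives of \<open>G\<close> are \<open>- G B\<^sub>k G\<close>, and a second differentiation gives
  \<open>G B\<^sub>k G B\<^sub>l G + G B\<^sub>l G B\<^sub>k G\<close>. The resistance distances and the Kirchhoff index are linear
  functionals of \<open>G\<close>, the latter being \<open>n tr G\<close> because \<open>G J = 0\<close>.
\<close>

subsection \<open>Matrix algebra\<close>

text \<open>In finite dimension bilinearity already gives boundedness. The interpretation below then
  supplies limits, the product rule and distributivity for matrix products.\<close>

lemma bounded_bilinear_matrix_matrix_mult:
  "bounded_bilinear ((**) :: real ^ 'm ^ 'n \<Rightarrow> real ^ 'p ^ 'm \<Rightarrow> real ^ 'p ^ 'n)"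
  unfolding bilinear_conv_bounded_bilinear [symmetric] bilinear_def
  by (intro conjI allI linearI)
    (simp_all add: matrix_matrix_mult_def vec_eq_iff field_simps sum.distrib sum_distrib_left)

interpretation matrix_mult: bounded_bilinear
  "(**) :: real ^ 'm ^ 'n \<Rightarrow> real ^ 'p ^ 'm \<Rightarrow> real ^ 'p ^ 'n"
  by (rule bounded_bilinear_matrix_matrix_mult)

lemma moore_penrose_inverse_eq:
  assumes "is_moore_penrose A X"
  shows "moore_penrose_inverse A = X"
  unfolding moore_penrose_inverse_def
  using assms by (rule the_equality) (rule is_moore_penrose_unique [OF _ assms])

lemma linear_pair_form: "linear (\<lambda>P. pair_form P i j)"
  by (rule linearI) (simp_all add: pair_form_def algebra_simps)

text \<open>The orthogonal projection \<open>J\<close> onto the constant vectors.\<close>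

definition averaging :: "real ^ 'n ^ 'n" where
  "averaging = (\<chi> s t. 1 / real CARD('n))"

lemma averaging_idem: "averaging ** averaging = averaging"
  by (simp add: averaging_def matrix_matrix_mult_def vec_eq_iff)

lemma transpose_averaging: "transpose averaging = averaging"
  by (simp add: averaging_def transpose_def)

lemma averaging_vector: "(averaging *v v) $ s = (\<Sum>t\<in>UNIV. v $ t) / real CARD('n)"
  for v :: "real ^ 'n"
  by (simp add: averaging_def matrix_vector_mult_def sum_divide_distrib)

lemma row_sum_eq_zero:
  fixes P :: "real ^ 'n ^ 'n"
  assumes "P ** averaging = 0"
  shows "(\<Sum>t\<in>UNIV. P $ s $ t) = 0"
proof -
  have "(P ** averaging) $ s $ s = 0"
    using assms by simp
  then show ?thesis
    by (simp add: averaging_def matrix_matrix_mult_def flip: sum_divide_distrib)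
qed

text \<open>\<open>pair_form\<close> is symmetric in the two indices and vanishes on the diagonal,
  so the sum over \<open>i < j\<close> is half the sum over all pairs. There the diagonal entries
  give twice \<open>n\<close> times the trace, and the mixed entries cancel because every row of
  \<open>P\<close> sums to zero.\<close>

lemma sum_pair_form:
  fixes P :: "real ^ 'n::{finite,linorder} ^ 'n::{finite,linorder}"
  assumes "P ** averaging = 0"
  shows "(\<Sum>(i, j)\<in>{(i, j). i < j}. pair_form P i j) = real CARD('n) * trace P"
proof -
  let ?f = "\<lambda>(i, j). pair_form P i j"
  let ?lt = "{(i, j). i < j} :: ('n \<times> 'n) set"
  let ?gt = "{(i, j). j < i} :: ('n \<times> 'n) set"
  let ?eq = "{(i, j). i = j} :: ('n \<times> 'n) set"
  have "sum ?f ?gt = sum ?f ?lt"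
    by (rule sum.reindex_bij_witness [where i = prod.swap and j = prod.swap])
      (auto simp: pair_form_def)
  moreover have "sum ?f ?eq = 0"
    by (rule sum.neutral) (auto simp: pair_form_def)
  moreover have "sum ?f UNIV = sum ?f (?lt \<union> ?gt \<union> ?eq)"
    by (rule arg_cong [where f = "sum ?f"]) auto
  moreover have "\<dots> = sum ?f ?lt + sum ?f ?gt + sum ?f ?eq"
    by (subst sum.union_disjoint; (subst sum.union_disjoint)?) (auto intro: finite_subset)
  ultimately have "2 * sum ?f ?lt = sum ?f UNIV"
    by simp
  also have "\<dots> = (\<Sum>i\<in>UNIV. \<Sum>j\<in>UNIV. pair_form P i j)"
    by (simp add: sum.cartesian_product)
  also have "\<dots> = 2 * (real CARD('n) * trace P)
      - (\<Sum>i\<in>UNIV. \<Sum>j\<in>UNIV. P $ i $ j) - (\<Sum>i\<in>UNIV. \<Sum>j\<in>UNIV. P $ j $ i)"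
    by (simp add: pair_form_def trace_def sum.distrib sum_subtractf flip: sum_distrib_left)
  also have "(\<Sum>i\<in>UNIV. \<Sum>j\<in>UNIV. P $ j $ i) = (\<Sum>i\<in>UNIV. \<Sum>j\<in>UNIV. P $ i $ j)"
    by (rule sum.swap)
  finally show ?thesis
    using row_sum_eq_zero [OF assms] by simp
qed

subsection \<open>The Laplacian and its pseudoinverse\<close>

text \<open>This form covers both the change of a single weight and the expansion over the
  edges.\<close>

lemma laplacian_lincomb:
  "laplacian m e (\<lambda>j. a j + c * b j) = laplacian m e a + c *\<^sub>R laplacian m e b"
proof -
  have "adjacency_matrix m e (\<lambda>j. a j + c * b j)
      = adjacency_matrix m e a + c *\<^sub>R adjacency_matrix m e b"
    by (simp add: adjacency_matrix_def vec_eq_iff)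
  then show ?thesis
    by (simp add: laplacian_def degree_matrix_def vec_eq_iff sum.distrib sum_distrib_left
        algebra_simps)
qed

locale connected_enumeration =
  fixes m :: nat and e :: "nat \<Rightarrow> 'n::finite set"
  assumes connected: "connected_graph (e ` {1..m})"
    and inj: "inj_on e {1..m}"
begin

definition positive :: "(nat \<Rightarrow> real) \<Rightarrow> bool" where
  "positive x \<longleftrightarrow> (\<forall>k\<in>{1..m}. x k > 0)"

abbreviation Lap :: "(nat \<Rightarrow> real) \<Rightarrow> real ^ 'n ^ 'n" where
  "Lap \<equiv> laplacian m e"

abbreviation Lap_edge :: "nat \<Rightarrow> real ^ 'n ^ 'n" where
  "Lap_edge k \<equiv> Lap (\<lambda>j. if j = k then 1 else 0)"

abbreviation pinv :: "(nat \<Rightarrow> real) \<Rightarrow> real ^ 'n ^ 'n" where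
  "pinv x \<equiv> moore_penrose_inverse (Lap x)"

lemma adjacency_sym: "adjacency_matrix m e x $ s $ t = adjacency_matrix m e x $ t $ s"
  by (simp add: adjacency_matrix_def insert_commute)

lemma adjacency_edge:
  assumes "k \<in> {1..m}" "{s, t} = e k"
  shows "adjacency_matrix m e x $ s $ t = x k"
  using assms inj by (auto simp: adjacency_matrix_def the_inv_into_f_f)

lemma adjacency_nonedge:
  assumes "{s, t} \<notin> e ` {1..m}"
  shows "adjacency_matrix m e x $ s $ t = 0"
  using assms by (simp add: adjacency_matrix_def)

lemma adjacency_nonneg:
  assumes "positive x"
  shows "adjacency_matrix m e x $ s $ t \<ge> 0"
  using assms inj the_inv_into_into [OF inj _ order_refl, of "{s, t}"]
  by (auto simp: adjacency_matrix_def positive_def less_imp_le)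

lemma laplacian_nth: "Lap x $ s $ t
    = (if s = t then (\<Sum>u\<in>UNIV. adjacency_matrix m e x $ s $ u) else 0)
      - adjacency_matrix m e x $ s $ t"
  by (simp add: laplacian_def degree_matrix_def)

lemma transpose_laplacian: "transpose (Lap x) = Lap x"
  by (simp add: transpose_def vec_eq_iff laplacian_nth adjacency_sym)

lemma laplacian_row_sum: "(\<Sum>t\<in>UNIV. Lap x $ s $ t) = 0"
  by (simp add: laplacian_nth sum_subtractf)

lemma laplacian_averaging: "Lap x ** averaging = 0"
  using laplacian_row_sum [of x]
  by (simp add: averaging_def matrix_matrix_mult_def vec_eq_iff flip: sum_divide_distrib)

lemma averaging_laplacian: "averaging ** Lap x = 0"
proof -
  have "transpose (Lap x ** averaging) = 0"
    by (simp add: laplacian_averaging transpose_def vec_eq_iff)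
  then show ?thesis
    by (simp add: matrix_transpose_mul transpose_averaging transpose_laplacian)
qed

lemma laplacian_update: "Lap (x(k := t)) = Lap x + (t - x k) *\<^sub>R Lap_edge k"
proof -
  have "x(k := t) = (\<lambda>j. x j + (t - x k) * (if j = k then 1 else 0))"
    by auto
  then show ?thesis
    by (simp add: laplacian_lincomb)
qed

lemma laplacian_zero: "Lap (\<lambda>_. 0) = 0"
  by (simp add: laplacian_def degree_matrix_def adjacency_matrix_def vec_eq_iff)

lemma laplacian_cong:
  assumes "\<And>k. k \<in> {1..m} \<Longrightarrow> a k = b k"
  shows "Lap a = Lap b"
proof -
  have "adjacency_matrix m e a = adjacency_matrix m e b"
    using assms the_inv_into_into [OF inj _ order_refl]
    by (auto simp: adjacency_matrix_def vec_eq_iff)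
  then show ?thesis
    by (simp only: laplacian_def degree_matrix_def)
qed

text \<open>Weights are cut off outside a finite index set \<open>S\<close>, which grows by one
  index at a time. For \<open>S = {1..m}\<close> the cut-off is invisible to the Laplacian.\<close>

lemma laplacian_sum_edges: "Lap a = (\<Sum>k\<in>{1..m}. a k *\<^sub>R Lap_edge k)"
proof -
  have *: "Lap (\<lambda>j. if j \<in> S then a j else 0) = (\<Sum>k\<in>S. a k *\<^sub>R Lap_edge k)" if "finite S" for S
    using that
  proof (induction S)
    case empty
    then show ?case by (simp add: laplacian_zero)
  next
    case (insert k S)
    have "(\<lambda>j. if j \<in> insert k S then a j else 0)
        = (\<lambda>j. (if j \<in> S then a j else 0) + a k * (if j = k then 1 else 0))"
      using insert.hyps by auto
    then show ?case
      using insert by (simp only: laplacian_lincomb) simp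
  qed
  show ?thesis
    unfolding * [symmetric, OF finite_atLeastAtMost] by (rule laplacian_cong) simp
qed

text \<open>A kernel vector has zero Dirichlet energy, the sum of
  \<open>?A s t * (v $ s - v $ t)\<^sup>2\<close>. All terms are nonnegative, so \<open>v\<close>
  agrees across every edge, and connectedness carries this along paths.\<close>

lemma laplacian_kernel:
  assumes "positive x" "Lap x *v v = 0"
  shows "v $ s = v $ t"
proof -
  let ?A = "\<lambda>s t. adjacency_matrix m e x $ s $ t"
  have row: "(\<Sum>t\<in>UNIV. ?A s t * (v $ s - v $ t)) = 0" for s
  proof -
    have "(Lap x *v v) $ s = (\<Sum>t\<in>UNIV. (if s = t then (\<Sum>u\<in>UNIV. ?A s u) * v $ s else 0) - ?A s t * v $ t)"
      unfolding matrix_vector_mult_def vec_lambda_beta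
      by (intro sum.cong) (simp_all add: laplacian_nth left_diff_distrib)
    also have "\<dots> = (\<Sum>t\<in>UNIV. ?A s t * (v $ s - v $ t))"
      by (simp add: sum_subtractf right_diff_distrib sum_distrib_right)
    finally have "(\<Sum>t\<in>UNIV. ?A s t * (v $ s - v $ t)) = (Lap x *v v) $ s" ..
    then show ?thesis
      using assms(2) by simp
  qed
  have "(\<Sum>s\<in>UNIV. \<Sum>t\<in>UNIV. ?A s t * (v $ s - v $ t) * v $ s) = 0"
    using row by (simp flip: sum_distrib_right)
  \<comment> \<open>Exchanging the roles of \<open>s\<close> and \<open>t\<close> turns this sum, up
    to sign, into the preceding one, as the adjacency matrix is symmetric.\<close>
  moreover have "(\<Sum>s\<in>UNIV. \<Sum>t\<in>UNIV. ?A s t * (v $ s - v $ t) * v $ t) = 0"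
  proof -
    have "(\<Sum>s\<in>UNIV. \<Sum>t\<in>UNIV. ?A s t * (v $ s - v $ t) * v $ t)
        = (\<Sum>t\<in>UNIV. \<Sum>s\<in>UNIV. ?A s t * (v $ s - v $ t) * v $ t)"
      by (rule sum.swap)
    also have "\<dots> = (\<Sum>t\<in>UNIV. \<Sum>s\<in>UNIV. - (?A t s * (v $ t - v $ s) * v $ t))"
    proof (intro sum.cong refl)
      fix s t
      show "?A s t * (v $ s - v $ t) * v $ t = - (?A t s * (v $ t - v $ s) * v $ t)"
        unfolding adjacency_sym [of x s t] by (simp add: algebra_simps)
    qed
    also have "\<dots> = - (\<Sum>t\<in>UNIV. (\<Sum>s\<in>UNIV. ?A t s * (v $ t - v $ s)) * v $ t)"
      by (simp only: sum_negf sum_distrib_right)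
    finally show ?thesis
      using row by simp
  qed
  moreover have "?A s t * (v $ s - v $ t)\<^sup>2
      = ?A s t * (v $ s - v $ t) * v $ s - ?A s t * (v $ s - v $ t) * v $ t" for s t
    by (simp add: power2_eq_square algebra_simps)
  ultimately have "(\<Sum>s\<in>UNIV. \<Sum>t\<in>UNIV. ?A s t * (v $ s - v $ t)\<^sup>2) = 0"
    by (simp only: sum_subtractf)
  then have zero: "?A s t * (v $ s - v $ t)\<^sup>2 = 0" for s t
    using adjacency_nonneg [OF assms(1)]
    by (simp add: sum_nonneg_eq_0_iff sum_nonneg)
  have edge: "v $ s = v $ t" if "{s, t} \<in> e ` {1..m}" for s t
  proof -
    from that obtain k where k: "k \<in> {1..m}" "{s, t} = e k"
      by auto
    then have "?A s t > 0"
      using adjacency_edge assms(1) by (simp add: positive_def)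
    then show ?thesis
      using zero [of s t] by simp
  qed
  have "(s, t) \<in> {(s, t). {s, t} \<in> e ` {1..m}}\<^sup>*"
    using connected by (simp add: connected_graph_def)
  then show ?thesis
  proof induction
    case (step y z)
    then show ?case
      using edge [of y z] by simp
  qed simp
qed

text \<open>These identities are all that the later arguments use about the pseudoinverse. Its
  existence is obtained by exhibiting \<open>?G\<close>; uniqueness then identifies it with
  \<open>pinv x\<close>.\<close>

lemma pinv_characterization:
  assumes "positive x"
  shows "Lap x ** pinv x = mat 1 - averaging" "pinv x ** Lap x = mat 1 - averaging"
    "averaging ** pinv x = 0" "pinv x ** averaging = 0"
proof -
  let ?J = "averaging :: real ^ 'n ^ 'n"
  let ?M = "Lap x + ?J"
  have JM: "?J ** ?M = ?J" and MJ: "?M ** ?J = ?J"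
    by (simp_all add: matrix_mult.add_left matrix_mult.add_right averaging_idem
        laplacian_averaging averaging_laplacian)
  have ker: "v = 0" if "?M *v v = 0" for v
  proof -
    \<comment> \<open>Applying \<open>?J\<close> to \<open>?M *v v = 0\<close> isolates the
      averaging part, which leaves \<open>v\<close> in the kernel of the Laplacian.\<close>
    have "?J *v v = (?J ** ?M) *v v"
      by (simp only: JM)
    also have "\<dots> = ?J *v (?M *v v)"
      by (simp only: matrix_vector_mul_assoc)
    finally have J0: "?J *v v = 0"
      by (simp add: that)
    then have "Lap x *v v = 0"
      using that by (simp add: matrix_vector_mult_add_rdistrib)
    then have const: "v $ s = v $ t" for s t
      using laplacian_kernel assms by blast
    have "v $ s = 0" for s
    proof -
      \<comment> \<open>Averaging fixes a constant vector, yet it sends \<open>v\<close> to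
        zero.\<close>
      have "(?J *v v) $ s = v $ s"
        unfolding averaging_vector by (subst sum.cong [OF refl const [of _ s]]) simp
      then show ?thesis
        by (simp add: J0)
    qed
    then show ?thesis
      by (simp add: vec_eq_iff)
  qed
  then obtain N where NM: "N ** ?M = mat 1"
    using matrix_left_invertible_ker by blast
  then have MN: "?M ** N = mat 1"
    by (simp add: matrix_left_right_inverse)
  have "?J ** N = ?J ** (?M ** N)" "N ** ?J = (N ** ?M) ** ?J"
    using JM MJ by (simp_all add: matrix_mul_assoc) (simp add: MJ flip: matrix_mul_assoc)
  then have JN: "?J ** N = ?J" and NJ: "N ** ?J = ?J"
    by (simp_all add: MN NM)
  let ?G = "N - ?J"
  note diffs = matrix_mult.diff_left matrix_mult.diff_right
  have JG: "?J ** ?G = 0" and GJ: "?G ** ?J = 0"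
    by (simp_all add: diffs JN NJ averaging_idem)
  \<comment> \<open>Since \<open>?J\<close> annihilates \<open>?G\<close> on both sides, the
    Laplacian may be replaced by the invertible \<open>?M\<close>.\<close>
  have "Lap x ** ?G = ?M ** ?G - ?J ** ?G" "?G ** Lap x = ?G ** ?M - ?G ** ?J"
    by (simp_all add: matrix_mult.add_left matrix_mult.add_right)
  then have LG: "Lap x ** ?G = mat 1 - ?J" and GL: "?G ** Lap x = mat 1 - ?J"
    by (simp_all add: JG GJ) (simp_all add: diffs MN NM JM MJ)
  have "is_moore_penrose (Lap x) ?G"
  proof -
    have "(mat 1 - ?J) ** Lap x = Lap x" "(mat 1 - ?J) ** ?G = ?G"
      by (simp_all add: matrix_mult.diff_left [of "mat 1"] averaging_laplacian JG)
    moreover have "transpose (mat 1 - ?J) = mat 1 - ?J"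
      by (simp add: transpose_def averaging_def mat_def vec_eq_iff)
    ultimately show ?thesis
      unfolding is_moore_penrose_def LG GL by simp
  qed
  then have "pinv x = ?G"
    by (rule moore_penrose_inverse_eq)
  then show "Lap x ** pinv x = mat 1 - averaging" "pinv x ** Lap x = mat 1 - averaging"
    "averaging ** pinv x = 0" "pinv x ** averaging = 0"
    using LG GL JG GJ by simp_all
qed

text \<open>The projection \<open>mat 1 - averaging\<close> is the same for all positive weights and
  acts as the identity on both pseudoinverses, so the usual resolvent computation goes through
  despite singularity.\<close>

lemma pinv_resolvent:
  assumes "positive x" "positive y"
  shows "pinv y - pinv x = pinv y ** (Lap x - Lap y) ** pinv x"
proof -
  have "pinv y ** (Lap x - Lap y) ** pinv x
      = pinv y ** (Lap x ** pinv x) - (pinv y ** Lap y) ** pinv x"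
    by (simp add: matrix_mult.diff_left matrix_mult.diff_right matrix_mul_assoc)
  then show ?thesis
    using assms
    by (simp add: pinv_characterization matrix_mult.diff_left matrix_mult.diff_right)
qed

subsection \<open>Derivatives of the pseudoinverse\<close>

lemma positive_update: "positive x \<Longrightarrow> t > 0 \<Longrightarrow> positive (x(k := t))"
  by (simp add: positive_def)

lemma eventually_positive_update:
  assumes "positive x" "k \<in> {1..m}"
  shows "\<forall>\<^sub>F t in nhds (x k). positive (x(k := t))"
proof -
  have "\<forall>\<^sub>F t in nhds (x k). t > 0"
    using assms eventually_nhds_in_open [of "{0<..}" "x k"] by (simp add: positive_def)
  then show ?thesis
    by eventually_elim (use assms positive_update in blast)
qed

text \<open>The right-hand side still contains the pseudoinverse at the updated weights, so
  continuity has to be settled before differentiability.\<close>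

lemma pinv_update_diff:
  assumes "positive x" "positive (x(k := t))"
  shows "pinv (x(k := t)) - pinv x = - ((t - x k) *\<^sub>R (pinv (x(k := t)) ** Lap_edge k ** pinv x))"
  unfolding pinv_resolvent [OF assms]
  by (simp add: laplacian_update matrix_mult.minus_left matrix_mult.minus_right
      matrix_mult.scaleR_left matrix_mult.scaleR_right)

text \<open>No bound on the nearby pseudoinverses is known beforehand. The resolvent identity bounds
  the difference by a small multiple of \<open>norm (?G t)\<close>, and absorbing that term yields
  such a bound.\<close>

lemma tendsto_pinv_update:
  assumes "positive x" "k \<in> {1..m}"
  shows "((\<lambda>t. pinv (x(k := t))) \<longlongrightarrow> pinv x) (at (x k))"
proof -
  let ?G = "\<lambda>t. pinv (x(k := t))"
  obtain K where K: "K > 0"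
    "\<And>A :: real ^ 'n ^ 'n. norm (A ** (Lap_edge k ** pinv x)) \<le> norm A * K"
    using bounded_linear.pos_bounded [OF matrix_mult.bounded_linear_left] by blast
  have "((\<lambda>t. \<bar>t - x k\<bar> * K) \<longlongrightarrow> \<bar>x k - x k\<bar> * K) (at (x k))"
    by (intro tendsto_intros)
  then have lim0: "((\<lambda>t. \<bar>t - x k\<bar> * K) \<longlongrightarrow> 0) (at (x k))"
    by simp
  \<comment> \<open>With the factor below 1/2, the triangle inequality gives
    \<open>norm (?G t) \<le> 2 * norm (pinv x)\<close>.\<close>
  then have small: "\<forall>\<^sub>F t in at (x k). \<bar>t - x k\<bar> * K < 1 / 2"
    by (rule order_tendstoD) simp
  have pos: "\<forall>\<^sub>F t in at (x k). positive (x(k := t))"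
    using eventually_positive_update [OF assms] by (simp add: eventually_at_filter eventually_mono)
  have bound: "\<forall>\<^sub>F t in at (x k). norm (?G t - pinv x) \<le> (\<bar>t - x k\<bar> * K) * (2 * norm (pinv x))"
    using small pos
  proof eventually_elim
    case (elim t)
    have step: "norm (?G t - pinv x) \<le> (\<bar>t - x k\<bar> * K) * norm (?G t)"
    proof -
      have "norm (?G t - pinv x) = \<bar>t - x k\<bar> * norm (?G t ** (Lap_edge k ** pinv x))"
        by (simp add: pinv_update_diff [OF assms(1) elim(2)] matrix_mul_assoc)
      also have "\<dots> \<le> \<bar>t - x k\<bar> * (norm (?G t) * K)"
        by (intro mult_left_mono K(2)) simp
      finally show ?thesis by (simp add: mult_ac)
    qed
    also have "\<dots> \<le> 1 / 2 * norm (?G t)"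
      using elim(1) by (intro mult_right_mono) auto
    finally have "norm (?G t) \<le> 2 * norm (pinv x)"
      using norm_triangle_ineq2 [of "?G t" "pinv x"] by linarith
    then have "(\<bar>t - x k\<bar> * K) * norm (?G t) \<le> (\<bar>t - x k\<bar> * K) * (2 * norm (pinv x))"
      using K(1) by (intro mult_left_mono) auto
    with step show ?case by linarith
  qed
  have "((\<lambda>t. (\<bar>t - x k\<bar> * K) * (2 * norm (pinv x))) \<longlongrightarrow> 0) (at (x k))"
    using tendsto_mult_left_zero [OF lim0] .
  with bound show ?thesis
    by (rule LIM_zero_cancel [OF Lim_null_comparison])
qed

text \<open>By the resolvent identity the remainder of the linear approximation is exactly
  \<open>- ((t - x k) *\<^sub>R ?r t)\<close>, and \<open>?r\<close> tends to zero by
  continuity.\<close>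

lemma has_vector_derivative_pinv:
  assumes "positive x" "k \<in> {1..m}"
  shows "((\<lambda>t. pinv (x(k := t))) has_vector_derivative - (pinv x ** Lap_edge k ** pinv x)) (at (x k))"
  unfolding has_vector_derivative_def has_derivative_at_within
proof (intro conjI bounded_linear_scaleR_left)
  let ?G = "\<lambda>t. pinv (x(k := t))"
  let ?q = "\<lambda>t. (?G t - ?G (x k) - (t - x k) *\<^sub>R - (pinv x ** Lap_edge k ** pinv x)) /\<^sub>R norm (t - x k)"
  let ?r = "\<lambda>t. (?G t - pinv x) ** (Lap_edge k ** pinv x)"
  have "\<forall>\<^sub>F t in at (x k). positive (x(k := t))"
    using eventually_positive_update [OF assms] by (simp add: eventually_at_filter eventually_mono)
  then have "\<forall>\<^sub>F t in at (x k). norm (?q t) \<le> norm (?r t)"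
  proof eventually_elim
    case (elim t)
    have "?G t - ?G (x k) - (t - x k) *\<^sub>R - (pinv x ** Lap_edge k ** pinv x) = - ((t - x k) *\<^sub>R ?r t)"
      unfolding matrix_mult.diff_left matrix_mul_assoc
      unfolding fun_upd_triv pinv_update_diff [OF assms(1) elim]
      by (simp add: scaleR_diff_right)
    \<comment> \<open>At \<open>t = x k\<close> the inverse of zero is zero, so \<open>?q t\<close>
      vanishes.\<close>
    then show ?case
      by (cases "t = x k") (simp_all add: abs_mult)
  qed
  moreover have "(?r \<longlongrightarrow> (pinv x - pinv x) ** (Lap_edge k ** pinv x)) (at (x k))"
    by (intro matrix_mult.tendsto tendsto_diff tendsto_pinv_update assms tendsto_const)
  then have "((\<lambda>t. norm (?r t)) \<longlongrightarrow> 0) (at (x k))"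
    by (simp add: matrix_mult.zero_left tendsto_norm_zero)
  ultimately show "(?q \<longlongrightarrow> 0) (at (x k))"
    by (rule Lim_null_comparison)
qed

lemma has_vector_derivative_pinv_edge_pinv:
  assumes "positive x" "k \<in> {1..m}"
  shows "((\<lambda>t. pinv (x(k := t)) ** B ** pinv (x(k := t))) has_vector_derivative
    - (pinv x ** B ** pinv x ** Lap_edge k ** pinv x
      + pinv x ** Lap_edge k ** pinv x ** B ** pinv x)) (at (x k))"
  using matrix_mult.has_vector_derivative
    [OF matrix_mult.has_vector_derivative [OF has_vector_derivative_pinv [OF assms]
        has_vector_derivative_const [of B]] has_vector_derivative_pinv [OF assms]]
  by (simp add: matrix_mult.zero_right matrix_mult.minus_left matrix_mult.minus_right
      matrix_mul_assoc)

section \<open>Hessians of linear functionals of the pseudoinverse\<close>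

context
  fixes \<phi> :: "real ^ 'n ^ 'n \<Rightarrow> real" and f :: "(nat \<Rightarrow> real) \<Rightarrow> real"
  assumes \<phi>: "linear \<phi>" and f: "f = (\<lambda>x. \<phi> (pinv x))"
begin

lemma linear_has_real_derivative:
  assumes "(g has_vector_derivative g') F"
  shows "((\<lambda>t. \<phi> (g t)) has_real_derivative \<phi> g') F"
  unfolding has_real_derivative_iff_has_vector_derivative
  using \<phi> assms unfolding linear_conv_bounded_linear
  by (rule bounded_linear.has_vector_derivative)

lemma has_partial_deriv:
  assumes "positive x" "k \<in> {1..m}"
  shows "((\<lambda>t. f (x(k := t))) has_real_derivative
    - \<phi> (pinv x ** Lap_edge k ** pinv x)) (at (x k))"
  using linear_has_real_derivative [OF has_vector_derivative_pinv [OF assms]]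
  by (simp add: f linear_neg [OF \<phi>])

lemma partial_deriv_eq:
  assumes "positive x" "k \<in> {1..m}"
  shows "partial_deriv k f x = - \<phi> (pinv x ** Lap_edge k ** pinv x)"
  unfolding partial_deriv_def by (rule DERIV_imp_deriv [OF has_partial_deriv [OF assms]])

text \<open>The first-order formula holds for every positive value \<open>t\<close> of the
  \<open>k\<close>-th weight, hence on an open half-line around \<open>x k\<close>, and may be
  differentiated once more there.\<close>

lemma has_second_partial_deriv:
  assumes "positive x" "k \<in> {1..m}" "l \<in> {1..m}"
  shows "((\<lambda>t. partial_deriv l f (x(k := t))) has_real_derivative
    \<phi> (pinv x ** Lap_edge l ** pinv x ** Lap_edge k ** pinv x)
      + \<phi> (pinv x ** Lap_edge k ** pinv x ** Lap_edge l ** pinv x)) (at (x k))"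
proof (rule has_field_derivative_transform_within_open)
  show "((\<lambda>t. - \<phi> (pinv (x(k := t)) ** Lap_edge l ** pinv (x(k := t)))) has_real_derivative
    \<phi> (pinv x ** Lap_edge l ** pinv x ** Lap_edge k ** pinv x)
      + \<phi> (pinv x ** Lap_edge k ** pinv x ** Lap_edge l ** pinv x)) (at (x k))"
    using DERIV_minus [OF linear_has_real_derivative
        [OF has_vector_derivative_pinv_edge_pinv [OF assms(1,2), of "Lap_edge l"]]]
    by (simp add: linear_neg [OF \<phi>] linear_add [OF \<phi>] linear_diff [OF \<phi>] add.commute)
  show "open {0::real<..}" "x k \<in> {0<..}"
    using assms by (auto simp: positive_def)
  show "- \<phi> (pinv (x(k := t)) ** Lap_edge l ** pinv (x(k := t))) = partial_deriv l f (x(k := t))"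
    if "t \<in> {0<..}" for t
    using that assms by (simp add: partial_deriv_eq positive_update)
qed

lemma hessian_exists_pinv:
  assumes "positive x"
  shows "hessian_exists m f x"
  unfolding hessian_exists_def
proof (intro ballI conjI)
  fix k l assume kl: "k \<in> {1..m}" "l \<in> {1..m}"
  show "\<forall>\<^sub>F t in nhds (x k). partially_differentiable l f (x(k := t))"
    using eventually_positive_update [OF assms kl(1)]
  proof eventually_elim
    case (elim t)
    show ?case
      unfolding partially_differentiable_def
      using has_partial_deriv [OF elim kl(2)] real_differentiable_def by blast
  qed
  show "partially_differentiable k (partial_deriv l f) x"
    unfolding partially_differentiable_def
    using has_second_partial_deriv [OF assms kl] real_differentiable_def by blast
qed

text \<open>The two orders of the edge matrices contribute equally after renaming \<open>k\<close>
  and \<open>l\<close>, whence the factor 2. By linearity the remaining double sum reassembles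
  \<open>Lap v\<close> in both places.\<close>

lemma quadratic_form_hessian_pinv:
  assumes "positive x"
  shows "quadratic_form m (hessian f x) v
    = 2 * \<phi> (pinv x ** Lap v ** pinv x ** Lap v ** pinv x)"
proof -
  let ?h = "\<lambda>k l. \<phi> (pinv x ** Lap_edge k ** pinv x ** Lap_edge l ** pinv x)"
  have "hessian f x k l = ?h l k + ?h k l" if "k \<in> {1..m}" "l \<in> {1..m}" for k l
    unfolding hessian_def partial_deriv_def [of k]
    by (rule DERIV_imp_deriv [OF has_second_partial_deriv [OF assms that]])
  then have "quadratic_form m (hessian f x) v
      = (\<Sum>k=1..m. \<Sum>l=1..m. v k * (?h l k + ?h k l) * v l)"
    unfolding quadratic_form_def by (intro sum.cong) auto
  also have "\<dots> = (\<Sum>k=1..m. \<Sum>l=1..m. v k * v l * ?h l k) + (\<Sum>k=1..m. \<Sum>l=1..m. v k * v l * ?h k l)"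
    by (simp add: algebra_simps sum.distrib)
  also have "(\<Sum>k=1..m. \<Sum>l=1..m. v k * v l * ?h l k) = (\<Sum>k=1..m. \<Sum>l=1..m. v k * v l * ?h k l)"
    by (subst sum.swap) (simp add: mult.commute [of "v _" "v _"])
  also have "(\<Sum>k=1..m. \<Sum>l=1..m. v k * v l * ?h k l)
      = \<phi> (pinv x ** Lap v ** pinv x ** Lap v ** pinv x)"
    unfolding laplacian_sum_edges [of v]
    by (subst sum.swap) (simp add: matrix_mult.sum_left matrix_mult.sum_right matrix_mult.scaleR_left
        matrix_mult.scaleR_right linear_sum [OF \<phi>] linear_cmul [OF \<phi>] sum_distrib_left mult_ac)
  finally show ?thesis by simp
qed

end

text \<open>Stated with the entrywise conditions that describe \<open>L\<^sub>1\<close>, so as to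
  recognise it as the Laplacian of the weight change.\<close>

lemma laplacian_eqI:
  assumes "\<And>s t k. k \<in> {1..m} \<Longrightarrow> {s, t} = e k \<Longrightarrow> M $ s $ t = - v k"
    and "\<And>s t. s \<noteq> t \<Longrightarrow> {s, t} \<notin> e ` {1..m} \<Longrightarrow> M $ s $ t = 0"
    and "\<And>s. M $ s $ s = (\<Sum>t\<in>UNIV - {s}. - (M $ s $ t))"
  shows "M = Lap v"
proof -
  have off: "M $ s $ t = - adjacency_matrix m e v $ s $ t" if "s \<noteq> t" for s t
  proof (cases "{s, t} \<in> e ` {1..m}")
    case True
    then obtain k where "k \<in> {1..m}" "{s, t} = e k" by auto
    then show ?thesis using assms(1) adjacency_edge by simp
  next
    case False
    then show ?thesis using assms(2) that adjacency_nonedge by simp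
  qed
  have "M $ s $ t = Lap v $ s $ t" for s t
  proof (cases "s = t")
    case True
    have "M $ s $ s = (\<Sum>t\<in>UNIV - {s}. adjacency_matrix m e v $ s $ t)"
      unfolding assms(3) [of s] by (intro sum.cong) (auto simp: off)
    \<comment> \<open>The term \<open>u = s\<close> in the row sum of the adjacency matrix cancels
      against the subtracted diagonal entry.\<close>
    then show ?thesis
      using True by (simp add: laplacian_nth sum.remove [of UNIV s])
  next
    case False
    then show ?thesis by (simp add: off laplacian_nth)
  qed
  then show ?thesis by (simp add: vec_eq_iff)
qed

end

section \<open>Second-order forms of resistance distances and Kirchhoff index\<close>

theorem theorem3p2:
  fixes e :: "nat \<Rightarrow> 'n::{finite,linorder} set"
    and E :: "'n::{finite,linorder} set set"
    and m :: nat
    and x \<Delta>x :: "nat \<Rightarrow> real"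
    and L L\<^sub>1 :: "real ^ 'n::{finite,linorder} ^ 'n::{finite,linorder}"
  assumes "simple_graph_edges E"
    and "connected_graph E"
    and "bij_betw e {1..m} E"
    and "\<And>k. k \<in> {1..m} \<Longrightarrow> x k > 0"
    and "\<And>k. k \<in> {1..m} \<Longrightarrow> x k + \<Delta>x k > 0"
    and "L = laplacian m e x"
    and "\<And>s t k. k \<in> {1..m} \<Longrightarrow> {s, t} = e k \<Longrightarrow> L\<^sub>1 $ s $ t = - \<Delta>x k"
    and "\<And>s t. s \<noteq> t \<Longrightarrow> {s, t} \<notin> E \<Longrightarrow> L\<^sub>1 $ s $ t = 0"
    and "\<And>s. L\<^sub>1 $ s $ s = (\<Sum>t\<in>UNIV - {s}. - (L\<^sub>1 $ s $ t))"
  shows "(\<forall>i j. hessian_exists m (resistance m e i j) x \<and>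
            quadratic_form m (hessian (resistance m e i j) x) \<Delta>x =
              2 * pair_form (moore_penrose_inverse L ** L\<^sub>1 ** moore_penrose_inverse L ** L\<^sub>1
                ** moore_penrose_inverse L) i j) \<and>
         (hessian_exists m (kirchhoff_index m e) x \<and>
            quadratic_form m (hessian (kirchhoff_index m e) x) \<Delta>x =
              2 * real CARD('n) * trace ((moore_penrose_inverse L ** moore_penrose_inverse L)
                ** L\<^sub>1 ** moore_penrose_inverse L ** L\<^sub>1))"
proof -
  have E: "E = e ` {1..m}"
    using assms(3) by (simp add: bij_betw_def)
  interpret connected_enumeration m e
    using assms(2,3) by unfold_locales (simp_all add: E bij_betw_def)
  have pos: "positive x"
    using assms(4) by (simp add: positive_def)
  have L1: "L\<^sub>1 = laplacian m e \<Delta>x"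
    using assms(7-9) unfolding E by (rule laplacian_eqI)
  let ?G = "moore_penrose_inverse L"
  let ?P = "?G ** L\<^sub>1 ** ?G ** L\<^sub>1 ** ?G"
  \<comment> \<open>The Kirchhoff index, like each resistance distance, is a linear functional of
    the pseudoinverse, so the same Hessian formula serves both.\<close>
  let ?kf = "\<lambda>P :: real ^ 'n::{finite,linorder} ^ 'n::{finite,linorder}. \<Sum>(i, j)\<in>{(i, j). i < j}. pair_form P i j"
  have res: "resistance m e i j = (\<lambda>x. pair_form (pinv x) i j)" for i j
    by (simp add: resistance_def fun_eq_iff)
  have kf: "kirchhoff_index m e = (\<lambda>x. ?kf (pinv x))"
    by (simp add: kirchhoff_index_def resistance_def fun_eq_iff)
  have linear_kf: "linear ?kf"
    unfolding case_prod_beta by (intro linear_compose_sum ballI linear_pair_form)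
  \<comment> \<open>The last factor of \<open>?P\<close> already annihilates constant vectors, so
    the sum over pairs reduces to a trace.\<close>
  have "?P ** averaging = 0"
    by (simp add: assms(6) pinv_characterization(4) [OF pos] matrix_mult.zero_right
        flip: matrix_mul_assoc)
  then have "?kf ?P = real CARD('n) * trace ?P"
    by (rule sum_pair_form)
  \<comment> \<open>Cyclicity of the trace moves the last factor to the front.\<close>
  also have "trace ?P = trace (?G ** ?G ** L\<^sub>1 ** ?G ** L\<^sub>1)"
    using trace_mul_sym [of "?G ** L\<^sub>1 ** ?G ** L\<^sub>1" ?G] by (simp add: matrix_mul_assoc)
  finally show ?thesis
    using hessian_exists_pinv [OF linear_pair_form res pos]
      quadratic_form_hessian_pinv [OF linear_pair_form res pos, of _ _ \<Delta>x]
      hessian_exists_pinv [OF linear_kf kf pos]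
      quadratic_form_hessian_pinv [OF linear_kf kf pos, of \<Delta>x]
    by (simp add: assms(6) L1)
qed

end
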